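(* For all $\alpha,\beta\in\mathbb{N}^3$ and all real $\mu\geqslant0$, $$D(\alpha,\beta,\mu)=\sum_{\substack{\lambda\preceq\alpha\\ 2|(\alpha-\lambda)}}\mathcal{C}(\alpha,\lambda)\sum_{\substack{\kappa\preceq\lambda\\ 2|(\lambda-\kappa)}}C_\lambda^\kappa\left(\frac{1-e}{2}\right)^{|\kappa|}\left(\frac{1+e}{2}\right)^{|\lambda|-|\kappa|}\mathcal{S}(\lambda-\kappa)\,\mathcal{V}(\kappa,\beta,|\lambda|-|\kappa|+\mu)$$ and $$\psi(\alpha,\beta,\mu)=4\pi\sum_{\substack{\lambda\preceq\alpha\\ 2|(\alpha-\lambda)}}\mathcal{C}(\alpha,\lambda)\,\mathcal{V}(\lambda,\beta,\mu),$$ where $\lambda,\kappa$ range over $\mathbb{N}^3$ and $C_\lambda^\kappa=C_{\lambda_1}^{\kappa_1}C_{\lambda_2}^{\kappa_2}C_{\lambda_3}^{\kappa_3}$.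
   Context: $\mathbb{N}$ includes $0$. For $\alpha\in\mathbb{N}^3$, $|\alpha|=\alpha_1+\alpha_2+\alpha_3$; $\lambda\preceq\alpha$ means $\lambda_s\leqslant\alpha_s$ for $s=1,2,3$; $2|\kappa$ means all components of $\kappa$ are even; $\boldsymbol{v}^\kappa=v_1^{\kappa_1}v_2^{\kappa_2}v_3^{\kappa_3}$. $C_n^k=\frac{n!}{k!(n-k)!}$ for $0\leqslant k\leqslant n$ and $C_n^k=0$ otherwise. The convention $0^0=1$ is used. The weight is $\omega(\boldsymbol{v})=(2\pi)^{-3/2}\exp(-|\boldsymbol{v}|^2/2)$ on $\mathbb{R}^3$, and the Hermite polynomials are $$H_\alpha(\boldsymbol{v})=\frac{(-1)^{|\alpha|}}{\omega(\boldsymbol{v})}\frac{\partial^{|\alpha|}}{\partial v_1^{\alpha_1}\partial v_2^{\alpha_2}\partial v_3^{\alpha_3}}\omega(\boldsymbol{v}).$$ For $n,k\in\mathbb{N}$, $\mathcal{C}(n,k)$ is the coefficient of $x^k$ in the one-dimensional standard (probabilists') Hermite polynomial $H_n(x)=(-1)^ne^{x^2/2}\frac{\mathrm{d}^n}{\mathrm{d}x^n}e^{-x^2/2}$, and $\mathcal{C}(\alpha,\beta)=\mathcal{C}(\alpha_1,\beta_1)\mathcal{C}(\alpha_2,\beta_2)\mathcal{C}(\alpha_3,\beta_3)$ for $\alpha,\beta\in\mathbb{N}^3$. $S^2$ is the unit sphere in $\mathbb{R}^3$ with surface measure $\mathrm{d}\sigma$. For $\kappa,\alpha\in\mathbb{N}^3$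 and $\mu\geqslant0$, $$\mathcal{S}(\kappa)=\int_{S^2}\sigma_1^{\kappa_1}\sigma_2^{\kappa_2}\sigma_3^{\kappa_3}\,\mathrm{d}\sigma,\qquad \mathcal{V}(\kappa,\alpha,\mu)=\int_{\mathbb{R}^3}\boldsymbol{v}^\kappa H_\alpha(\boldsymbol{v})|\boldsymbol{v}|^\mu\omega(\boldsymbol{v})\,\mathrm{d}\boldsymbol{v}.$$ The restitution coefficient $e\in[0,1]$ is a constant, and for $\boldsymbol{g}\in\mathbb{R}^3$, $\sigma\in S^2$, $$\boldsymbol{g}'=\frac{1-e}{2}\boldsymbol{g}+\frac{1+e}{2}|\boldsymbol{g}|\sigma.$$ Finally, $$D(\alpha,\beta,\mu)=\int_{\mathbb{R}^3}\int_{S^2}H_\alpha(\boldsymbol{g}')H_\beta(\boldsymbol{g})|\boldsymbol{g}|^\mu\omega(\boldsymbol{g})\,\mathrm{d}\sigma\,\mathrm{d}\boldsymbol{g},\qquad \psi(\alpha,\beta,\mu)=\int_{\mathbb{R}^3}\int_{S^2}H_\alpha(\boldsymbol{g})H_\beta(\boldsymbol{g})|\boldsymbol{g}|^\mu\omega(\boldsymbol{g})\,\mathrm{d}\sigma\,\mathrm{d}\boldsymbol{g}.$$ *)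

theory Defs
  imports "HOL-Analysis.Analysis" "HOL-Computational_Algebra.Polynomial"
begin

section \<open>Multi-indices\<close>

text \<open>Multi-indices are vectors of type \<^typ>\<open>nat^3\<close>; the library order \<open>\<le>\<close> on them is the
  componentwise one, and subtraction is componentwise.\<close>

definition mlen :: "nat^3 \<Rightarrow> nat" where
  "mlen \<alpha> = (\<Sum>i\<in>UNIV. \<alpha> $ i)"

definition meven :: "nat^3 \<Rightarrow> bool" where
  "meven \<kappa> \<longleftrightarrow> (\<forall>i. even (\<kappa> $ i))"

definition monom3 :: "real^3 \<Rightarrow> nat^3 \<Rightarrow> real" where
  "monom3 v \<kappa> = (\<Prod>i\<in>UNIV. (v $ i) ^ (\<kappa> $ i))"

definition mchoose :: "nat^3 \<Rightarrow> nat^3 \<Rightarrow> nat" where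
  "mchoose \<nu> \<kappa> = (\<Prod>i\<in>UNIV. (\<nu> $ i) choose (\<kappa> $ i))"

section \<open>Hermite polynomials\<close>

definition partial_deriv :: "3 \<Rightarrow> (real^3 \<Rightarrow> real) \<Rightarrow> real^3 \<Rightarrow> real" where
  "partial_deriv i f v = deriv (\<lambda>t. f (v + t *\<^sub>R axis i 1)) 0"

definition mpartial_deriv :: "nat^3 \<Rightarrow> (real^3 \<Rightarrow> real) \<Rightarrow> real^3 \<Rightarrow> real" where
  "mpartial_deriv \<alpha> f =
     (partial_deriv 1 ^^ (\<alpha> $ 1)) ((partial_deriv 2 ^^ (\<alpha> $ 2)) ((partial_deriv 3 ^^ (\<alpha> $ 3)) f))"

definition gauss_weight :: "real^3 \<Rightarrow> real" where
  "gauss_weight v = (2 * pi) powr (- (3 / 2)) * exp (- (norm v)\<^sup>2 / 2)"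

definition Hermite :: "nat^3 \<Rightarrow> real^3 \<Rightarrow> real" where
  "Hermite \<alpha> v = (- 1) ^ mlen \<alpha> / gauss_weight v * mpartial_deriv \<alpha> gauss_weight v"

definition hermite1 :: "nat \<Rightarrow> real \<Rightarrow> real" where
  "hermite1 n x = (- 1) ^ n * exp (x\<^sup>2 / 2) * (deriv ^^ n) (\<lambda>y. exp (- y\<^sup>2 / 2)) x"

definition hermite1_poly :: "nat \<Rightarrow> real poly" where
  "hermite1_poly n = (THE p. \<forall>x. poly p x = hermite1 n x)"

definition hermite_coeff1 :: "nat \<Rightarrow> nat \<Rightarrow> real" where
  "hermite_coeff1 n k = coeff (hermite1_poly n) k"

definition hermite_coeff :: "nat^3 \<Rightarrow> nat^3 \<Rightarrow> real" where
  "hermite_coeff \<alpha> \<beta> = (\<Prod>i\<in>UNIV. hermite_coeff1 (\<alpha> $ i) (\<beta> $ i))"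

text \<open>The definite description in \<^const>\<open>hermite1_poly\<close> is proper.\<close>

lemma poly_hermite1_poly: "poly (hermite1_poly n) x = hermite1 n x"
proof -
  let ?g = "\<lambda>y::real. exp (- y\<^sup>2 / 2)"
  have "\<exists>p. \<forall>x. (deriv ^^ n) ?g x = poly p x * ?g x"
  proof (induction n)
    case 0
    show ?case by (intro exI[of _ 1]) auto
  next
    case (Suc n)
    then obtain p where p: "\<And>x. (deriv ^^ n) ?g x = poly p x * ?g x" by blast
    have fe: "(deriv ^^ n) ?g = (\<lambda>x. poly p x * ?g x)" using p by blast
    have "(deriv ^^ Suc n) ?g x = poly (pderiv p - [:0, 1:] * p) x * ?g x" for x
    proof -
      have "((\<lambda>x. poly p x * ?g x) has_field_derivative
              poly (pderiv p - [:0, 1:] * p) x * ?g x) (at x)"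
        by (auto intro!: derivative_eq_intros simp: algebra_simps)
      then show ?thesis by (simp only: funpow.simps o_apply fe DERIV_imp_deriv)
    qed
    then show ?case by blast
  qed
  then obtain p where p: "\<And>x. (deriv ^^ n) ?g x = poly p x * ?g x" by blast
  have "exp (x\<^sup>2 / 2) * ?g x = 1" for x
    by (simp flip: exp_add)
  then have h: "hermite1 n = poly (smult ((- 1) ^ n) p)"
    by (simp only: hermite1_def p fun_eq_iff poly_smult mult.left_commute mult.assoc) simp
  have "hermite1_poly n = smult ((- 1) ^ n) p"
    unfolding hermite1_poly_def h
    by (rule the_equality) (auto simp only: poly_eq_poly_eq_iff simp flip: fun_eq_iff)
  then show ?thesis by (simp only: h)
qed

section \<open>Surface measure on the unit sphere\<close>

text \<open>The measure of a Borel set of unit vectors is the dimension times the volume of the cone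
  over it, as in polar coordinates \<open>dx = r\<^sup>n\<^sup>-\<^sup>1 dr d\<sigma>\<close>. \<close>

definition sphere_measure :: "'a::euclidean_space measure" where
  "sphere_measure =
     distr (scale_measure (of_nat DIM('a)) (restrict_space lborel (ball 0 1 - {0})))
           (restrict_space borel (sphere 0 1)) sgn"

lemma space_sphere_measure [simp]: "space sphere_measure = sphere 0 1"
  and sets_sphere_measure [measurable_cong]:
    "sets sphere_measure = sets (restrict_space borel (sphere 0 1))"
  by (auto simp: sphere_measure_def space_restrict_space)

lemma measurable_sgn_sphere:
  "sgn \<in> scale_measure c (restrict_space lborel (ball 0 1 - {0}))
     \<rightarrow>\<^sub>M restrict_space borel (sphere (0::'a::euclidean_space) 1)"
proof -
  have "sgn \<in> restrict_space lborel (ball 0 1 - {0}) \<rightarrow>\<^sub>M (borel :: 'a measure)"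
    unfolding sgn_div_norm by (intro measurable_restrict_space1) measurable
  then have "sgn \<in> restrict_space lborel (ball 0 1 - {0})
               \<rightarrow>\<^sub>M restrict_space borel (sphere (0::'a) 1)"
    by (intro measurable_restrict_space2) (auto simp: space_restrict_space norm_sgn)
  then show ?thesis
    by (simp add: measurable_def space_scale_measure)
qed

lemma emeasure_sphere_measure:
  fixes A :: "'a::euclidean_space set"
  assumes "A \<in> sets sphere_measure"
  shows "emeasure sphere_measure A =
           of_nat DIM('a) * emeasure lborel {x. x \<noteq> 0 \<and> norm x < 1 \<and> sgn x \<in> A}"
proof -
  have "{x. x \<noteq> 0 \<and> norm x < 1 \<and> sgn x \<in> A} = sgn -` A \<inter> (ball 0 1 - {0})"
    by auto
  then show ?thesis
    using assms measurable_sgn_sphere[of "of_nat DIM('a)", where 'a = 'a]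
    unfolding sphere_measure_def
    by (simp add: emeasure_distr space_restrict_space space_scale_measure emeasure_restrict_space)
qed

lemma emeasure_sphere_measure_space:
  "emeasure sphere_measure (sphere (0::real^3) 1) = ennreal (4 * pi)"
proof -
  have "sphere (0::real^3) 1 \<in> sets sphere_measure"
    by (metis space_sphere_measure sets.top)
  then have "emeasure sphere_measure (sphere (0::real^3) 1) =
        3 * emeasure lborel {x::real^3. x \<noteq> 0 \<and> norm x < 1 \<and> sgn x \<in> sphere 0 1}"
    by (simp add: emeasure_sphere_measure)
  also have "{x::real^3. x \<noteq> 0 \<and> norm x < 1 \<and> sgn x \<in> sphere 0 1} = ball 0 1 - {0}"
    by (auto simp: norm_sgn)
  also have "emeasure lborel (ball (0::real^3) 1 - {0}) = emeasure lborel (ball (0::real^3) 1)"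
    by (rule emeasure_Diff_null_set) (auto simp: null_sets_def)
  also have "\<dots> = ennreal (4 / 3 * pi)"
    by (simp add: emeasure_ball unit_ball_vol_3)
  also have "3 * \<dots> = ennreal (4 * pi)"
    by (simp flip: ennreal_numeral ennreal_mult add: ennreal_mult'[symmetric])
  finally show ?thesis .
qed

text \<open>Rotation invariance; together with the total mass \<open>4\<pi>\<close> it characterizes the surface measure
  on the unit sphere.\<close>

lemma emeasure_sphere_measure_orthogonal:
  fixes T :: "real^3 \<Rightarrow> real^3"
  assumes T: "orthogonal_transformation T" and A: "A \<in> sets sphere_measure"
  shows "emeasure sphere_measure (T -` A \<inter> sphere 0 1) = emeasure sphere_measure A"
proof -
  let ?C = "\<lambda>A. {x::real^3. x \<noteq> 0 \<and> norm x < 1 \<and> sgn x \<in> A}"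
  have lin: "linear T" and nT: "\<And>x. norm (T x) = norm x"
    using T by (auto simp: orthogonal_transformation)
  have sgnT: "sgn (T x) = T (sgn x)" for x
    by (simp add: sgn_div_norm nT linear_cmul[OF lin])
  have T0: "T x = 0 \<longleftrightarrow> x = 0" for x
    using nT by (metis norm_eq_zero)
  have sC: "?C B \<in> sets borel" if "B \<in> sets sphere_measure" for B
  proof -
    from that have "B \<in> sets borel"
      by (auto simp: sets_sphere_measure sets_restrict_space)
    moreover have "?C B = (sgn -` B \<inter> space borel) \<inter> (ball 0 1 - {0})"
      by auto
    moreover have "(sgn :: real^3 \<Rightarrow> _) \<in> borel \<rightarrow>\<^sub>M borel"
      unfolding sgn_div_norm by measurable
    ultimately show ?thesis
      using measurable_sets[of sgn borel borel B] by (simp only:) (intro sets.Int sets.Diff; simp)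
  qed
  have mT: "T \<in> borel \<rightarrow>\<^sub>M borel"
    using lin by (intro borel_measurable_continuous_onI linear_continuous_on)
      (simp add: linear_conv_bounded_linear)
  have A': "T -` A \<inter> sphere 0 1 \<in> sets sphere_measure"
  proof -
    from A obtain B where "B \<in> sets borel" "A = sphere 0 1 \<inter> B"
      by (auto simp: sets_sphere_measure sets_restrict_space)
    then have "T -` A \<inter> sphere 0 1 = sphere 0 1 \<inter> (T -` B \<inter> space borel)"
      by (auto simp: nT)
    then show ?thesis
      using measurable_sets[OF mT \<open>B \<in> sets borel\<close>]
      by (auto simp: sets_sphere_measure sets_restrict_space)
  qed
  have img: "T ` ?C (T -` A \<inter> sphere 0 1) = ?C A"
  proof
    show "T ` ?C (T -` A \<inter> sphere 0 1) \<subseteq> ?C A"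
      by (auto simp: T0 nT sgnT)
    show "?C A \<subseteq> T ` ?C (T -` A \<inter> sphere 0 1)"
    proof
      fix y assume y: "y \<in> ?C A"
      obtain x where "y = T x"
        using orthogonal_transformation_surj[OF T] by (metis surj_def)
      with y show "y \<in> T ` ?C (T -` A \<inter> sphere 0 1)"
        by (auto simp: T0 nT sgnT norm_sgn)
    qed
  qed
  have lm: "?C B \<in> lmeasurable" if "B \<in> sets sphere_measure" for B
    by (rule bounded_set_imp_lmeasurable)
       (use sC[OF that] in \<open>auto intro: bounded_subset[OF bounded_ball[of 0 1]]\<close>)
  have em: "emeasure lborel (?C B) = ennreal (measure lebesgue (?C B))"
    if "B \<in> sets sphere_measure" for B
    using emeasure_eq_measure2[OF lm[OF that]] sC[OF that] by simp
  show ?thesis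
    using measure_orthogonal_image[OF T lm[OF A']]
    by (simp only: img emeasure_sphere_measure[OF A] emeasure_sphere_measure[OF A'] em[OF A] em[OF A'])
qed

section \<open>The integrals\<close>

text \<open>Nonnegative real power with \<open>0\<^sup>0 = 1\<close>; note that \<^term>\<open>0 powr 0 = (0::real)\<close>.\<close>

definition rpow :: "real \<Rightarrow> real \<Rightarrow> real" where
  "rpow x \<mu> = (if \<mu> = 0 then 1 else x powr \<mu>)"

definition S_int :: "nat^3 \<Rightarrow> real" where
  "S_int \<kappa> = (LINT \<sigma>|sphere_measure. monom3 \<sigma> \<kappa>)"

definition V_int :: "nat^3 \<Rightarrow> nat^3 \<Rightarrow> real \<Rightarrow> real" where
  "V_int \<kappa> \<alpha> \<mu> = (LINT v|lborel. monom3 v \<kappa> * Hermite \<alpha> v * rpow (norm v) \<mu> * gauss_weight v)"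

definition post_velocity :: "real \<Rightarrow> real^3 \<Rightarrow> real^3 \<Rightarrow> real^3" where
  "post_velocity e g \<sigma> = ((1 - e) / 2) *\<^sub>R g + ((1 + e) / 2 * norm g) *\<^sub>R \<sigma>"

definition D_int :: "real \<Rightarrow> nat^3 \<Rightarrow> nat^3 \<Rightarrow> real \<Rightarrow> real" where
  "D_int e \<alpha> \<beta> \<mu> =
     (LINT g|lborel. LINT \<sigma>|sphere_measure.
        Hermite \<alpha> (post_velocity e g \<sigma>) * Hermite \<beta> g * rpow (norm g) \<mu> * gauss_weight g)"

definition psi_int :: "nat^3 \<Rightarrow> nat^3 \<Rightarrow> real \<Rightarrow> real" where
  "psi_int \<alpha> \<beta> \<mu> =
     (LINT g|lborel. LINT \<sigma>|(sphere_measure :: (real^3) measure).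
        Hermite \<alpha> g * Hermite \<beta> g * rpow (norm g) \<mu> * gauss_weight g)"

end

theory Submission
  imports Defs "HOL-Probability.Distributions"
begin

text \<open>Everything reduces to monomials. The Gaussian weight is a product of one-dimensional
  Gaussians, so \<open>Hermite \<alpha>\<close> is a product of one-dimensional Hermite polynomials, and each of
  these contains only powers of the parity of its degree. Multiplying out gives
  \<open>Hermite_expansion\<close>: a sum of monomials over the indices \<open>\<nu> \<le> \<alpha>\<close> with \<open>\<alpha> - \<nu>\<close> even. For \<open>psi\<close> the
  integrand does not depend on \<open>\<sigma>\<close>, and inserting this expansion already gives the claim, with the
  factor \<open>4\<pi>\<close> as the area of the sphere.

  For \<open>D\<close>, the post-collisional velocity is a linear combination of \<open>g\<close> and \<open>\<bar>g\<bar> \<sigma>\<close>, so a monomial in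
  it expands by the multi-index binomial theorem (\<open>monom3_linear_combination\<close>) into products of a
  monomial in \<open>g\<close>, a monomial in \<open>\<sigma>\<close> and a power of \<open>\<bar>g\<bar>\<close>. The inner integral acts on the monomials
  in \<open>\<sigma>\<close> alone and produces the moments \<open>S_int (\<nu> - \<kappa>)\<close>; those with an odd component vanish by
  reflecting one coordinate (\<open>S_int_eq_0\<close>). The power of \<open>\<bar>g\<bar>\<close> merges with \<open>\<bar>g\<bar>\<^sup>\<mu>\<close>, and the outer
  integral gives the \<open>V_int\<close>. The inner integral is thus explicit for every \<open>g\<close>, so
  the order of integration is never exchanged. What remains is to distribute the outer integral over
  a finite sum, for which every term must be integrable (\<open>integrable_V\<close>).\<close>

section \<open>Hermite polynomials\<close>

lemma iterated_deriv_gaussian: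
  "(deriv ^^ n) (\<lambda>y::real. exp (- y\<^sup>2 / 2)) x
     = (- 1) ^ n * poly (hermite1_poly n) x * exp (- x\<^sup>2 / 2)"
proof -
  have "exp (x\<^sup>2 / 2) * exp (- x\<^sup>2 / 2) = 1" "(- 1::real) ^ n * (- 1) ^ n = 1"
    by (simp_all flip: exp_add power_mult_distrib)
  then show ?thesis
    unfolding poly_hermite1_poly hermite1_def
    by (metis (no_types, lifting) mult.assoc mult.commute mult.right_neutral)
qed

lemma hermite1_poly_0: "hermite1_poly 0 = 1"
proof -
  have "poly (hermite1_poly 0) x = poly 1 x" for x
    using iterated_deriv_gaussian[of 0 x] by simp
  then show ?thesis by (simp add: poly_eq_poly_eq_iff[symmetric] fun_eq_iff)
qed

lemma hermite1_poly_Suc: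
  "hermite1_poly (Suc n) = [:0, 1:] * hermite1_poly n - pderiv (hermite1_poly n)"
proof -
  have "poly (hermite1_poly (Suc n)) x
      = poly ([:0, 1:] * hermite1_poly n - pderiv (hermite1_poly n)) x" for x
  proof -
    let ?p = "hermite1_poly n"
    have fe: "(deriv ^^ n) (\<lambda>y::real. exp (- y\<^sup>2 / 2)) = (\<lambda>x. (- 1) ^ n * poly ?p x * exp (- x\<^sup>2 / 2))"
      using iterated_deriv_gaussian by blast
    have "((\<lambda>x. (- 1) ^ n * poly ?p x * exp (- x\<^sup>2 / 2)) has_field_derivative
            (- 1) ^ Suc n * poly ([:0, 1:] * ?p - pderiv ?p) x * exp (- x\<^sup>2 / 2)) (at x)"
      by (auto intro!: derivative_eq_intros simp: algebra_simps)
    then have "(deriv ^^ Suc n) (\<lambda>y::real. exp (- y\<^sup>2 / 2)) x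
        = (- 1) ^ Suc n * poly ([:0, 1:] * ?p - pderiv ?p) x * exp (- x\<^sup>2 / 2)"
      by (simp only: funpow.simps o_apply fe DERIV_imp_deriv)
    then show ?thesis
      unfolding iterated_deriv_gaussian by (simp del: power_Suc)
  qed
  then show ?thesis by (intro poly_eq_poly_eq_iff[THEN iffD1] ext)
qed

text \<open>The recursion \<open>H\<^bsub>n+1\<^esub> = x H\<^bsub>n\<^esub> - H\<^bsub>n\<^esub>'\<close> shifts every exponent by one, up or down, hence
  preserves both the degree bound and the parity.\<close>

lemma hermite_coeff1_eq_0:
  assumes "\<not> (k \<le> n \<and> even (n - k))"
  shows "hermite_coeff1 n k = 0"
  using assms unfolding hermite_coeff1_def
proof (induction n arbitrary: k)
  case 0
  then show ?case by (auto simp: hermite1_poly_0 coeff_1 split: if_splits)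
next
  case (Suc n)
  have "coeff (hermite1_poly n) (Suc k) = 0"
    using Suc.prems by (intro Suc.IH) (auto simp: Suc_diff_le)
  moreover have "coeff (hermite1_poly n) (k - 1) = 0" if "k > 0"
    using Suc.prems that by (intro Suc.IH) (auto simp: Suc_diff_le)
  ultimately show ?case
    by (cases k) (auto simp: hermite1_poly_Suc coeff_pderiv)
qed

lemma hermite1_expansion:
  "hermite1 n x = (\<Sum>k | k \<le> n \<and> even (n - k). hermite_coeff1 n k * x ^ k)"
proof -
  have "degree (hermite1_poly n) \<le> n"
    by (rule degree_le) (metis hermite_coeff1_def hermite_coeff1_eq_0 not_le)
  then have "hermite1 n x = (\<Sum>k\<le>n. hermite_coeff1 n k * x ^ k)"
    unfolding hermite_coeff1_def poly_hermite1_poly[symmetric] poly_altdef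
    by (intro sum.mono_neutral_left) (auto simp: coeff_eq_0)
  also have "\<dots> = (\<Sum>k | k \<le> n \<and> even (n - k). hermite_coeff1 n k * x ^ k)"
    by (rule sum.mono_neutral_right) (auto simp: hermite_coeff1_eq_0)
  finally show ?thesis .
qed

lemma gauss_weight_eq_prod:
  "gauss_weight v = (2 * pi) powr (- (3 / 2)) * (\<Prod>i\<in>UNIV. exp (- (v $ i)\<^sup>2 / 2))"
proof -
  have "(norm v)\<^sup>2 = (\<Sum>i\<in>UNIV. (v $ i)\<^sup>2)"
    by (simp add: norm_vec_def L2_set_def sum_nonneg)
  then show ?thesis
    by (simp add: gauss_weight_def exp_sum[symmetric] sum_negf sum_divide_distrib)
qed

text \<open>Moving along the \<open>i\<close>-th axis changes only the \<open>i\<close>-th factor, so the family of products of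
  functions of single coordinates is closed under partial derivatives. The constant \<open>c\<close>
  carries the normalization of the Gaussian weight through the iteration.\<close>

lemma partial_deriv_prod:
  fixes f :: "3 \<Rightarrow> real \<Rightarrow> real"
  assumes "\<And>x. f i field_differentiable (at x)"
  shows "partial_deriv i (\<lambda>v. c * (\<Prod>j\<in>UNIV. f j (v $ j)))
    = (\<lambda>v. c * (\<Prod>j\<in>UNIV. (if j = i then deriv (f i) else f j) (v $ j)))"
proof
  fix v :: "real^3"
  let ?R = "\<Prod>j\<in>UNIV - {i}. f j (v $ j)"
  have "(\<Prod>j\<in>UNIV. f j ((v + t *\<^sub>R axis i 1) $ j)) = f i (v $ i + t) * ?R" for t
    by (subst prod.remove[of _ i]) (auto simp: axis_def intro!: prod.cong)
  moreover have "((\<lambda>t. c * (f i (v $ i + t) * ?R)) has_field_derivative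
      c * (deriv (f i) (v $ i) * ?R)) (at 0)"
  proof -
    have "((\<lambda>t. f i (t + v $ i)) has_field_derivative deriv (f i) (v $ i)) (at 0)"
      using assms[of "v $ i"] DERIV_shift[of "f i" "deriv (f i) (v $ i)" 0 "v $ i"]
      by (simp add: DERIV_deriv_iff_field_differentiable)
    then show ?thesis
      by (auto intro!: derivative_eq_intros simp: add.commute)
  qed
  moreover have "(\<Prod>j\<in>UNIV. (if j = i then deriv (f i) else f j) (v $ j)) = deriv (f i) (v $ i) * ?R"
    by (subst prod.remove[of _ i]) (auto intro!: prod.cong)
  ultimately show "partial_deriv i (\<lambda>v. c * (\<Prod>j\<in>UNIV. f j (v $ j))) v
    = c * (\<Prod>j\<in>UNIV. (if j = i then deriv (f i) else f j) (v $ j))"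
    unfolding partial_deriv_def by (simp add: DERIV_imp_deriv)
qed

lemma iterated_partial_deriv_prod:
  fixes f :: "3 \<Rightarrow> real \<Rightarrow> real"
  assumes "\<And>m x. (deriv ^^ m) (f i) field_differentiable (at x)"
  shows "(partial_deriv i ^^ n) (\<lambda>v. c * (\<Prod>j\<in>UNIV. f j (v $ j)))
    = (\<lambda>v. c * (\<Prod>j\<in>UNIV. (if j = i then (deriv ^^ n) (f i) else f j) (v $ j)))"
proof (induction n)
  case 0
  have "(if j = i then (deriv ^^ 0) (f i) else f j) = f j" for j by simp
  then show ?case by (simp only: funpow.simps id_apply)
next
  case (Suc n)
  let ?g = "\<lambda>j. if j = i then (deriv ^^ n) (f i) else f j"
  have "?g i field_differentiable (at x)" for x using assms by simp
  note partial_deriv_prod[of ?g i c, OF this]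
  moreover have "(if j = i then deriv (?g i) else ?g j)
      = (if j = i then (deriv ^^ Suc n) (f i) else f j)" for j by simp
  ultimately show ?case by (simp only: funpow.simps o_apply Suc)
qed

lemma Hermite_eq_prod: "Hermite \<alpha> v = (\<Prod>i\<in>UNIV. hermite1 (\<alpha> $ i) (v $ i))"
proof -
  let ?g = "\<lambda>y::real. exp (- y\<^sup>2 / 2)" and ?c = "(2 * pi) powr (- (3 / 2)) :: real"
  have diff: "(deriv ^^ m) ((deriv ^^ n) ?g) field_differentiable (at x)" for m n x
  proof -
    have "(deriv ^^ m) ((deriv ^^ n) ?g)
        = (\<lambda>x. (- 1) ^ (m + n) * poly (hermite1_poly (m + n)) x * exp (- x\<^sup>2 / 2))"
      unfolding funpow_add[unfolded fun_eq_iff o_def, rule_format, symmetric]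
      using iterated_deriv_gaussian by blast
    then show ?thesis
      by (auto intro!: derivative_eq_intros simp: field_differentiable_def)
  qed
  \<comment> \<open>All mixed partial derivatives of the weight that occur on the way, indexed by their orders.\<close>
  define E where "E a = (\<lambda>v::real^3. ?c * (\<Prod>j\<in>UNIV. (deriv ^^ a j) ?g (v $ j)))" for a
  have step: "(partial_deriv i ^^ n) (E a) = E (a(i := n + a i))" for i n a
    unfolding E_def iterated_partial_deriv_prod[of "\<lambda>j. (deriv ^^ a j) ?g", OF diff]
    by (intro ext arg_cong[where f = "\<lambda>x. ?c * x"] prod.cong) (auto simp: funpow_add)
  have gw: "gauss_weight = E (\<lambda>_. 0)"
    unfolding E_def by (rule ext) (simp add: gauss_weight_eq_prod)
  have "mpartial_deriv \<alpha> gauss_weight = E (($) \<alpha>)"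
    unfolding mpartial_deriv_def gw
    by (simp add: step) (rule arg_cong[where f = E], simp add: fun_eq_iff forall_3)
  then have "Hermite \<alpha> v = (- 1) ^ mlen \<alpha> / gauss_weight v *
      (?c * (\<Prod>j\<in>UNIV. (deriv ^^ (\<alpha> $ j)) ?g (v $ j)))"
    by (simp add: Hermite_def E_def)
  also have "\<dots> = (\<Prod>i\<in>UNIV. hermite1 (\<alpha> $ i) (v $ i))"
    unfolding gauss_weight_eq_prod mlen_def power_sum
    by (simp add: hermite1_def exp_minus prod.distrib prod_dividef prod_inversef field_simps)
  finally show ?thesis .
qed

text \<open>Distributivity, with choice functions encoded as vectors: this turns facts about each
  coordinate into facts about multi-indices.\<close>

lemma prod_sum_vec:
  fixes f :: "'n::finite \<Rightarrow> 'b \<Rightarrow> 'c::comm_semiring_1"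
  assumes "\<And>i. finite (A i)"
  shows "(\<Prod>i\<in>UNIV. \<Sum>k\<in>A i. f i k) = (\<Sum>x | \<forall>i. x $ i \<in> A i. \<Prod>i\<in>UNIV. f i (x $ i))"
proof -
  have "(\<Prod>i\<in>UNIV. \<Sum>k\<in>A i. f i k) = (\<Sum>g\<in>PiE UNIV A. \<Prod>i\<in>UNIV. f i (g i))"
    using assms by (intro prod_sum_PiE) auto
  also have "\<dots> = (\<Sum>x | \<forall>i. x $ i \<in> A i. \<Prod>i\<in>UNIV. f i (x $ i))"
    by (rule sum.reindex_bij_witness[of _ vec_nth vec_lambda]) auto
  finally show ?thesis .
qed

lemma Hermite_expansion:
  "Hermite \<alpha> v = (\<Sum>\<nu> | \<nu> \<le> \<alpha> \<and> meven (\<alpha> - \<nu>). hermite_coeff \<alpha> \<nu> * monom3 v \<nu>)"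
proof -
  have "Hermite \<alpha> v = (\<Sum>\<nu> | \<forall>i. \<nu> $ i \<in> {k. k \<le> \<alpha> $ i \<and> even (\<alpha> $ i - k)}.
      \<Prod>i\<in>UNIV. hermite_coeff1 (\<alpha> $ i) (\<nu> $ i) * (v $ i) ^ (\<nu> $ i))"
    unfolding Hermite_eq_prod hermite1_expansion by (rule prod_sum_vec) simp
  then show ?thesis
    by (simp add: hermite_coeff_def monom3_def prod.distrib less_eq_vec_def meven_def all_conj_distrib)
qed

section \<open>Monomials\<close>

lemma finite_vec_le: "finite {\<kappa>::nat^'n. \<kappa> \<le> \<nu>}"
proof -
  have "{\<kappa>. \<kappa> \<le> \<nu>} \<subseteq> vec_lambda ` (PiE UNIV (\<lambda>i. {..\<nu> $ i}))"
    by (auto simp: less_eq_vec_def image_iff intro!: bexI[of _ "vec_nth _"])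
  then show ?thesis
    by (rule finite_subset) (intro finite_imageI finite_PiE; simp)
qed

lemma monom3_add: "monom3 v (\<kappa> + \<nu>) = monom3 v \<kappa> * monom3 v \<nu>"
  by (simp add: monom3_def power_add prod.distrib)

lemma mlen_diff:
  assumes "\<kappa> \<le> \<nu>"
  shows "mlen (\<nu> - \<kappa>) = mlen \<nu> - mlen \<kappa>"
  using assms unfolding mlen_def less_eq_vec_def by (simp add: sum_subtractf_nat)

lemma mlen_mono: "\<kappa> \<le> \<nu> \<Longrightarrow> mlen \<kappa> \<le> mlen \<nu>"
  unfolding mlen_def less_eq_vec_def by (simp add: sum_mono)

text \<open>The multi-index binomial theorem: the binomial theorem in each coordinate, multiplied out.\<close>

lemma monom3_linear_combination:
  "monom3 (a *\<^sub>R g + b *\<^sub>R s) \<nu> =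
    (\<Sum>\<kappa> | \<kappa> \<le> \<nu>. real (mchoose \<nu> \<kappa>) * a ^ mlen \<kappa> * b ^ (mlen \<nu> - mlen \<kappa>)
       * monom3 s (\<nu> - \<kappa>) * monom3 g \<kappa>)"
proof -
  have "monom3 (a *\<^sub>R g + b *\<^sub>R s) \<nu> = (\<Sum>\<kappa> | \<forall>i. \<kappa> $ i \<in> {..\<nu> $ i}. \<Prod>i\<in>UNIV.
      real ((\<nu> $ i) choose (\<kappa> $ i)) * (a * g $ i) ^ (\<kappa> $ i) * (b * s $ i) ^ (\<nu> $ i - \<kappa> $ i))"
    unfolding monom3_def vector_add_component vector_scaleR_component real_scaleR_def binomial_ring
    by (rule prod_sum_vec) simp
  also have "\<dots> = (\<Sum>\<kappa> | \<kappa> \<le> \<nu>. real (mchoose \<nu> \<kappa>) * a ^ mlen \<kappa> * b ^ mlen (\<nu> - \<kappa>)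
       * monom3 s (\<nu> - \<kappa>) * monom3 g \<kappa>)"
    by (auto simp: less_eq_vec_def mchoose_def monom3_def mlen_def power_mult_distrib prod.distrib
        power_sum intro!: sum.cong)
  also have "\<dots> = (\<Sum>\<kappa> | \<kappa> \<le> \<nu>. real (mchoose \<nu> \<kappa>) * a ^ mlen \<kappa> * b ^ (mlen \<nu> - mlen \<kappa>)
       * monom3 s (\<nu> - \<kappa>) * monom3 g \<kappa>)"
    by (intro sum.cong) (auto simp: mlen_diff)
  finally show ?thesis .
qed

lemma abs_monom3_le: "\<bar>monom3 v \<kappa>\<bar> \<le> norm v ^ mlen \<kappa>"
  unfolding monom3_def abs_prod mlen_def power_sum
  by (intro prod_mono) (auto simp: power_abs component_le_norm_cart intro!: power_mono)

lemma borel_measurable_vec_nth [measurable]: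
  "(\<lambda>v::real^'n. v $ i) \<in> borel_measurable borel"
  by (intro borel_measurable_continuous_onI continuous_intros)

lemma borel_measurable_monom3 [measurable]: "(\<lambda>v. monom3 v \<kappa>) \<in> borel_measurable borel"
  unfolding monom3_def by measurable

section \<open>Integration over the sphere\<close>

lemma finite_measure_sphere: "finite_measure (sphere_measure :: (real^3) measure)"
  by (rule finite_measureI) (simp add: emeasure_sphere_measure_space)

lemma measure_sphere: "measure sphere_measure (sphere (0::real^3) 1) = 4 * pi"
  by (simp add: measure_def emeasure_sphere_measure_space)

lemma integrable_monom3_sphere: "integrable sphere_measure (\<lambda>\<sigma>. monom3 \<sigma> \<kappa>)"
proof -
  interpret finite_measure "sphere_measure :: (real^3) measure"
    by (rule finite_measure_sphere)
  show ?thesis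
  proof (rule integrable_const_bound[where B = 1])
    show "AE \<sigma> in sphere_measure. norm (monom3 \<sigma> \<kappa>) \<le> 1"
    proof (rule AE_I2)
      fix \<sigma> :: "real^3" assume "\<sigma> \<in> space sphere_measure"
      then show "norm (monom3 \<sigma> \<kappa>) \<le> 1" using abs_monom3_le[of \<sigma> \<kappa>] by simp
    qed
    show "(\<lambda>\<sigma>. monom3 \<sigma> \<kappa>) \<in> borel_measurable sphere_measure"
      unfolding measurable_cong_sets[OF sets_sphere_measure refl]
      by (intro measurable_restrict_space1) measurable
  qed
qed

text \<open>Changing the sign of a coordinate with odd exponent is an orthogonal transformation, which
  preserves the surface measure but negates the monomial.\<close>

lemma S_int_eq_0:
  assumes "\<not> meven \<kappa>"
  shows "S_int \<kappa> = 0"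
proof -
  from assms obtain i where i: "odd (\<kappa> $ i)" by (auto simp: meven_def)
  define T :: "real^3 \<Rightarrow> real^3" where "T v = (\<chi> j. if j = i then - (v $ j) else v $ j)" for v
  have T: "orthogonal_transformation T"
  proof -
    have "linear T" by (rule linearI) (auto simp: T_def vec_eq_iff)
    moreover have "norm (T v) = norm v" for v
      by (auto simp: T_def norm_vec_def intro!: L2_set_cong)
    ultimately show ?thesis by (simp add: orthogonal_transformation)
  qed
  have mT: "T \<in> borel \<rightarrow>\<^sub>M borel"
    using T by (intro borel_measurable_continuous_onI linear_continuous_on)
      (simp add: linear_conv_bounded_linear[symmetric] orthogonal_transformation)
  have mT': "T \<in> sphere_measure \<rightarrow>\<^sub>M sphere_measure"
    unfolding measurable_cong_sets[OF sets_sphere_measure sets_sphere_measure]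
    using T by (intro measurable_restrict_space3 mT) (auto simp: orthogonal_transformation)
  have dist: "distr sphere_measure sphere_measure T = sphere_measure"
    by (rule measure_eqI)
       (use T mT' in \<open>simp_all add: emeasure_distr emeasure_sphere_measure_orthogonal\<close>)
  have flip: "monom3 (T v) \<kappa> = - monom3 v \<kappa>" for v
  proof -
    have "monom3 (T v) \<kappa> = (- (v $ i)) ^ (\<kappa> $ i) * (\<Prod>j\<in>UNIV - {i}. (v $ j) ^ (\<kappa> $ j))"
      unfolding monom3_def by (subst prod.remove[of _ i]) (auto simp: T_def intro!: prod.cong)
    also have "\<dots> = - monom3 v \<kappa>"
      using i unfolding monom3_def by (subst prod.remove[of _ i, where g = "\<lambda>j. (v $ j) ^ (\<kappa> $ j)"]) auto
    finally show ?thesis .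
  qed
  have "S_int \<kappa> = (LINT \<sigma>|distr sphere_measure sphere_measure T. monom3 \<sigma> \<kappa>)"
    by (simp add: dist S_int_def)
  also have "\<dots> = (LINT \<sigma>|sphere_measure. monom3 (T \<sigma>) \<kappa>)"
    using integrable_monom3_sphere[of \<kappa>] by (intro integral_distr mT') auto
  also have "\<dots> = - S_int \<kappa>" by (simp add: flip S_int_def)
  finally show ?thesis by simp
qed

section \<open>Integrability against the Gaussian weight\<close>

text \<open>The Lebesgue measure is a product measure, so the integral of the absolute value factors.\<close>

lemma integrable_prod_vec:
  fixes f :: "'n::finite \<Rightarrow> real \<Rightarrow> real"
  assumes int: "\<And>i. integrable lborel (f i)"
  shows "integrable lborel (\<lambda>v::real^'n. \<Prod>i\<in>UNIV. f i (v $ i))"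
proof (rule integrableI_bounded)
  have [measurable]: "f i \<in> borel_measurable borel" for i
    using borel_measurable_integrable[OF int[of i]] by simp
  show "(\<lambda>v::real^'n. \<Prod>i\<in>UNIV. f i (v $ i)) \<in> borel_measurable lborel"
    by measurable
  have basis: "(\<Prod>b\<in>(Basis::(real^'n) set). h b) = (\<Prod>i\<in>UNIV. h (axis i 1))"
    for h :: "real^'n \<Rightarrow> ennreal"
  proof -
    have "(Basis::(real^'n) set) = range (\<lambda>i. axis i 1)" by (auto simp: Basis_vec_def)
    then show ?thesis unfolding \<open>Basis = _\<close> by (subst prod.reindex) (auto simp: inj_on_def axis_eq_axis)
  qed
  \<comment> \<open>The product formula for the Lebesgue measure ranges over basis vectors; this recovers the
    index of the coordinate that a basis vector belongs to.\<close>
  define ix :: "real^'n \<Rightarrow> 'n" where "ix b = (SOME i. b = axis i 1)" for b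
  have ix: "ix (axis i 1) = i" for i
    unfolding ix_def by (rule some1_equality) (auto simp: axis_eq_axis)
  have "(\<integral>\<^sup>+v. ennreal (norm (\<Prod>i\<in>UNIV. f i (v $ i))) \<partial>(lborel :: (real^'n) measure))
      = (\<integral>\<^sup>+v. (\<Prod>b\<in>Basis. ennreal \<bar>f (ix b) (v \<bullet> b)\<bar>) \<partial>(lborel :: (real^'n) measure))"
    by (simp add: basis ix inner_axis abs_prod prod_ennreal)
  also have "\<dots> = (\<Prod>b\<in>(Basis::(real^'n) set). \<integral>\<^sup>+x. ennreal \<bar>f (ix b) x\<bar> \<partial>lborel)"
    by (rule nn_integral_lborel_prod) auto
  also have "\<dots> = (\<Prod>i\<in>UNIV. \<integral>\<^sup>+x. ennreal \<bar>f i x\<bar> \<partial>lborel)"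
    by (simp add: basis ix)
  also have "\<dots> < \<infinity>"
    using int by (auto simp: integrable_iff_bounded less_top[symmetric] ennreal_prod_eq_top)
  finally show "(\<integral>\<^sup>+v. ennreal (norm (\<Prod>i\<in>UNIV. f i (v $ i))) \<partial>(lborel :: (real^'n) measure)) < \<infinity>" .
qed

lemma rpow_nonneg: "0 \<le> rpow x m"
  by (simp add: rpow_def)

text \<open>Replaces a real exponent by a natural one, so that polynomial moments of the Gaussian suffice
  for integrability. Enlarging the base to some \<open>y \<ge> 1\<close> is what makes the power monotone in the
  exponent.\<close>

lemma rpow_le_power:
  assumes "0 \<le> x" "x \<le> y" "1 \<le> y" "0 \<le> m"
  shows "rpow x m \<le> y ^ nat \<lceil>m\<rceil>"
proof (cases "m = 0")
  case True
  then show ?thesis by (simp add: rpow_def)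
next
  case False
  with assms have "x powr m \<le> y powr m" by (intro powr_mono2) auto
  also have "\<dots> \<le> y powr (real (nat \<lceil>m\<rceil>))"
    using assms by (intro powr_mono) auto
  also have "\<dots> = y ^ nat \<lceil>m\<rceil>"
    using assms by (intro powr_realpow) auto
  finally show ?thesis using False by (simp add: rpow_def)
qed

text \<open>This merges the powers of \<open>\<bar>g\<bar>\<close> that come from expanding monomials with the weight \<open>\<bar>g\<bar>\<^sup>\<mu>\<close>. At
  \<open>x = 0\<close> both sides are \<open>1\<close> if \<open>n = m = 0\<close>, by the convention \<open>0\<^sup>0 = 1\<close>, and \<open>0\<close> otherwise.\<close>

lemma power_mult_rpow:
  assumes "0 \<le> x" "0 \<le> m"
  shows "x ^ n * rpow x m = rpow x (real n + m)"
  using assms by (cases "x = 0") (auto simp: rpow_def powr_add powr_realpow power_0_left)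

text \<open>As \<open>\<bar>v\<bar> \<le> \<Prod>(1 + \<bar>v\<^sub>i\<bar>)\<close>, the integrand is dominated by a product of functions of single coordinates,
  each a combination of absolute moments of the standard normal density.\<close>

lemma integrable_rpow_gauss_weight:
  assumes "0 \<le> m"
  shows "integrable lborel (\<lambda>v. rpow (norm v) m * gauss_weight v)"
proof -
  define N where "N = nat \<lceil>m\<rceil>"
  let ?h = "\<lambda>x::real. (1 + \<bar>x\<bar>) ^ N * exp (- x\<^sup>2 / 2)"
  have "integrable lborel (\<lambda>x. std_normal_density x * (1 + \<bar>x\<bar>) ^ N)"
    unfolding binomial_ring sum_distrib_left
    by (intro Bochner_Integration.integrable_sum)
       (simp add: mult.left_commute[of "std_normal_density _"] integrable_std_normal_moment_abs)
  then have "integrable lborel (\<lambda>x. sqrt (2 * pi) * (std_normal_density x * (1 + \<bar>x\<bar>) ^ N))"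
    by (rule integrable_mult_right)
  then have "integrable lborel ?h"
    by (simp add: std_normal_density_def mult.commute)
  then have bound: "integrable lborel (\<lambda>v::real^3. (2 * pi) powr (- (3 / 2)) * (\<Prod>i\<in>UNIV. ?h (v $ i)))"
    by (intro integrable_mult_right integrable_prod_vec)
  show ?thesis
  proof (rule Bochner_Integration.integrable_bound[OF bound])
    show "(\<lambda>v. rpow (norm v) m * gauss_weight v) \<in> borel_measurable lborel"
      unfolding rpow_def gauss_weight_def by measurable
    have le: "rpow (norm v) m * gauss_weight v \<le> (2 * pi) powr (- (3 / 2)) * (\<Prod>i\<in>UNIV. ?h (v $ i))"
      for v :: "real^3"
    proof -
      have "norm v \<le> (\<Sum>i\<in>UNIV. \<bar>v $ i\<bar>)" by (rule norm_le_l1_cart)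
      also have "\<dots> \<le> (\<Prod>i\<in>UNIV. 1 + \<bar>v $ i\<bar>)" by (rule sum_le_prod) simp
      finally have "norm v \<le> (\<Prod>i\<in>UNIV. 1 + \<bar>v $ i\<bar>)" .
      moreover have "1 \<le> (\<Prod>i\<in>UNIV. 1 + \<bar>v $ i\<bar>)" by (rule prod_ge_1) simp
      ultimately have "rpow (norm v) m \<le> (\<Prod>i\<in>UNIV. (1 + \<bar>v $ i\<bar>) ^ N)"
        using rpow_le_power[of "norm v" _ m] assms by (simp add: N_def flip: prod_power_distrib)
      then have "rpow (norm v) m * gauss_weight v \<le> (\<Prod>i\<in>UNIV. (1 + \<bar>v $ i\<bar>) ^ N) * gauss_weight v"
        by (intro mult_right_mono) (auto simp: gauss_weight_def)
      also have "\<dots> = (2 * pi) powr (- (3 / 2)) * (\<Prod>i\<in>UNIV. ?h (v $ i))"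
        by (simp add: gauss_weight_eq_prod prod.distrib)
      finally show ?thesis .
    qed
    have nonneg: "0 \<le> rpow (norm v) m * gauss_weight v" for v
      by (simp add: rpow_nonneg gauss_weight_def)
    have "norm (rpow (norm v) m * gauss_weight v)
        \<le> norm ((2 * pi) powr (- (3 / 2)) * (\<Prod>i\<in>UNIV. ?h (v $ i)))" for v :: "real^3"
      unfolding real_norm_def abs_of_nonneg[OF nonneg] by (rule order_trans[OF le abs_ge_self])
    then show "AE v in lborel. norm (rpow (norm v) m * gauss_weight v)
        \<le> norm ((2 * pi) powr (- (3 / 2)) * (\<Prod>i\<in>UNIV. ?h (v $ i)))"
      by (rule AE_I2)
  qed
qed

text \<open>A monomial is bounded by a power of the norm, which only raises the exponent \<open>m\<close>.\<close>

lemma integrable_monom3_gauss_weight: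
  assumes "0 \<le> m"
  shows "integrable lborel (\<lambda>v. monom3 v \<kappa> * rpow (norm v) m * gauss_weight v)"
proof (rule Bochner_Integration.integrable_bound)
  show "integrable lborel (\<lambda>v::real^3. rpow (norm v) (real (mlen \<kappa>) + m) * gauss_weight v)"
    using assms by (intro integrable_rpow_gauss_weight) simp
  show "(\<lambda>v. monom3 v \<kappa> * rpow (norm v) m * gauss_weight v) \<in> borel_measurable lborel"
    unfolding rpow_def gauss_weight_def by measurable
  have "\<bar>monom3 v \<kappa> * rpow (norm v) m * gauss_weight v\<bar>
      \<le> rpow (norm v) (real (mlen \<kappa>) + m) * gauss_weight v" for v
    using assms abs_monom3_le[of v \<kappa>]
    by (auto simp: abs_mult rpow_nonneg gauss_weight_def simp flip: power_mult_rpow intro!: mult_right_mono)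
  then show "AE v in lborel. norm (monom3 v \<kappa> * rpow (norm v) m * gauss_weight v)
      \<le> norm (rpow (norm v) (real (mlen \<kappa>) + m) * gauss_weight v)"
    by (intro AE_I2) (simp add: abs_mult rpow_nonneg gauss_weight_def)
qed

lemma integrable_V:
  assumes "0 \<le> m"
  shows "integrable lborel (\<lambda>v. monom3 v \<kappa> * Hermite \<beta> v * rpow (norm v) m * gauss_weight v)"
proof -
  have "(\<lambda>v. monom3 v \<kappa> * Hermite \<beta> v * rpow (norm v) m * gauss_weight v) =
    (\<lambda>v. \<Sum>\<nu> | \<nu> \<le> \<beta> \<and> meven (\<beta> - \<nu>). hermite_coeff \<beta> \<nu> *
       (monom3 v (\<kappa> + \<nu>) * rpow (norm v) m * gauss_weight v))"
    by (simp add: Hermite_expansion monom3_add sum_distrib_left sum_distrib_right mult_ac)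
  then show ?thesis
    using assms by (simp add: integrable_monom3_gauss_weight)
qed

lemma integral_sphere_const: "(LINT \<sigma>|(sphere_measure :: (real^3) measure). c) = 4 * pi * (c::real)"
  by (simp add: measure_sphere)

section \<open>Expansions of the collision integrals\<close>

text \<open>The inner integral of \<open>D\<close> for a fixed relative velocity \<open>g\<close>. The factor \<open>\<bar>g\<bar>\<^sup>\<mu>\<close> is included on the
  left because it combines with the power of \<open>\<bar>g\<bar>\<close> that accompanies \<open>\<sigma>\<close>.\<close>

lemma integral_sphere_monom3_post_velocity:
  assumes "0 \<le> \<mu>"
  shows "(LINT \<sigma>|sphere_measure. monom3 (post_velocity e g \<sigma>) \<nu>) * rpow (norm g) \<mu>
    = (\<Sum>\<kappa> | \<kappa> \<le> \<nu> \<and> meven (\<nu> - \<kappa>).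
         real (mchoose \<nu> \<kappa>) * ((1 - e) / 2) ^ mlen \<kappa> * ((1 + e) / 2) ^ (mlen \<nu> - mlen \<kappa>)
         * S_int (\<nu> - \<kappa>) * (monom3 g \<kappa> * rpow (norm g) (real (mlen \<nu>) - real (mlen \<kappa>) + \<mu>)))"
proof -
  have "(LINT \<sigma>|sphere_measure. monom3 (post_velocity e g \<sigma>) \<nu>) =
     (\<Sum>\<kappa> | \<kappa> \<le> \<nu>. real (mchoose \<nu> \<kappa>) * ((1 - e) / 2) ^ mlen \<kappa>
        * ((1 + e) / 2 * norm g) ^ (mlen \<nu> - mlen \<kappa>) * S_int (\<nu> - \<kappa>) * monom3 g \<kappa>)"
    unfolding post_velocity_def monom3_linear_combination S_int_def
    by (simp add: integrable_monom3_sphere Bochner_Integration.integral_sum)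
  also have "\<dots> = (\<Sum>\<kappa> | \<kappa> \<le> \<nu> \<and> meven (\<nu> - \<kappa>). real (mchoose \<nu> \<kappa>) * ((1 - e) / 2) ^ mlen \<kappa>
        * ((1 + e) / 2 * norm g) ^ (mlen \<nu> - mlen \<kappa>) * S_int (\<nu> - \<kappa>) * monom3 g \<kappa>)"
    by (rule sum.mono_neutral_right) (auto simp: finite_vec_le S_int_eq_0)
  finally show ?thesis
  proof (simp only: sum_distrib_right, intro sum.cong[OF refl])
    fix \<kappa> assume "\<kappa> \<in> {\<kappa>. \<kappa> \<le> \<nu> \<and> meven (\<nu> - \<kappa>)}"
    then have eq: "real (mlen \<nu>) - real (mlen \<kappa>) = real (mlen \<nu> - mlen \<kappa>)"
      by (simp add: mlen_mono of_nat_diff)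
    show "real (mchoose \<nu> \<kappa>) * ((1 - e) / 2) ^ mlen \<kappa> * ((1 + e) / 2 * norm g) ^ (mlen \<nu> - mlen \<kappa>)
        * S_int (\<nu> - \<kappa>) * monom3 g \<kappa> * rpow (norm g) \<mu>
      = real (mchoose \<nu> \<kappa>) * ((1 - e) / 2) ^ mlen \<kappa> * ((1 + e) / 2) ^ (mlen \<nu> - mlen \<kappa>)
        * S_int (\<nu> - \<kappa>) * (monom3 g \<kappa> * rpow (norm g) (real (mlen \<nu>) - real (mlen \<kappa>) + \<mu>))"
      unfolding eq power_mult_rpow[OF norm_ge_zero assms, symmetric] power_mult_distrib
      by (simp only: mult_ac)
  qed
qed

lemma D_int_expansion:
  assumes "0 \<le> \<mu>"
  shows "D_int e \<alpha> \<beta> \<mu> =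
       (\<Sum>\<nu> | \<nu> \<le> \<alpha> \<and> meven (\<alpha> - \<nu>). hermite_coeff \<alpha> \<nu> *
         (\<Sum>\<kappa> | \<kappa> \<le> \<nu> \<and> meven (\<nu> - \<kappa>).
            real (mchoose \<nu> \<kappa>) * ((1 - e) / 2) ^ mlen \<kappa> * ((1 + e) / 2) ^ (mlen \<nu> - mlen \<kappa>)
            * S_int (\<nu> - \<kappa>) * V_int \<kappa> \<beta> (real (mlen \<nu>) - real (mlen \<kappa>) + \<mu>)))"
proof -
  define c where "c \<nu> \<kappa> = real (mchoose \<nu> \<kappa>) * ((1 - e) / 2) ^ mlen \<kappa>
      * ((1 + e) / 2) ^ (mlen \<nu> - mlen \<kappa>) * S_int (\<nu> - \<kappa>)" for \<nu> \<kappa>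
  define F where "F \<nu> \<kappa> g = monom3 g \<kappa> * Hermite \<beta> g
      * rpow (norm g) (real (mlen \<nu>) - real (mlen \<kappa>) + \<mu>) * gauss_weight g" for \<nu> \<kappa> g
  have intm: "integrable sphere_measure (\<lambda>\<sigma>. monom3 (post_velocity e g \<sigma>) \<nu>)" for g \<nu>
    unfolding post_velocity_def monom3_linear_combination
    by (simp add: integrable_monom3_sphere)
  have inner: "(LINT \<sigma>|sphere_measure. Hermite \<alpha> (post_velocity e g \<sigma>) * Hermite \<beta> g
      * rpow (norm g) \<mu> * gauss_weight g)
    = (\<Sum>\<nu> | \<nu> \<le> \<alpha> \<and> meven (\<alpha> - \<nu>). hermite_coeff \<alpha> \<nu> *
        (\<Sum>\<kappa> | \<kappa> \<le> \<nu> \<and> meven (\<nu> - \<kappa>). c \<nu> \<kappa> * F \<nu> \<kappa> g))" for g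
  proof -
    have "(LINT \<sigma>|sphere_measure. Hermite \<alpha> (post_velocity e g \<sigma>) * Hermite \<beta> g
        * rpow (norm g) \<mu> * gauss_weight g)
      = (\<Sum>\<nu> | \<nu> \<le> \<alpha> \<and> meven (\<alpha> - \<nu>). hermite_coeff \<alpha> \<nu> *
          (LINT \<sigma>|sphere_measure. monom3 (post_velocity e g \<sigma>) \<nu>))
        * (Hermite \<beta> g * rpow (norm g) \<mu> * gauss_weight g)"
      unfolding Hermite_expansion[of \<alpha>]
      by (simp add: intm Bochner_Integration.integral_sum mult.assoc)
    also have "\<dots> = (\<Sum>\<nu> | \<nu> \<le> \<alpha> \<and> meven (\<alpha> - \<nu>). hermite_coeff \<alpha> \<nu> *
          ((LINT \<sigma>|sphere_measure. monom3 (post_velocity e g \<sigma>) \<nu>) * rpow (norm g) \<mu>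
          * (Hermite \<beta> g * gauss_weight g)))"
      by (simp add: sum_distrib_left sum_distrib_right mult_ac)
    also have "\<dots> = (\<Sum>\<nu> | \<nu> \<le> \<alpha> \<and> meven (\<alpha> - \<nu>). hermite_coeff \<alpha> \<nu> *
        (\<Sum>\<kappa> | \<kappa> \<le> \<nu> \<and> meven (\<nu> - \<kappa>). c \<nu> \<kappa> * F \<nu> \<kappa> g))"
      unfolding integral_sphere_monom3_post_velocity[OF assms]
      by (intro sum.cong arg_cong2[where f = "(*)"] refl)
         (simp add: c_def F_def sum_distrib_right sum_distrib_left mult_ac)
    finally show ?thesis .
  qed
  have intF: "integrable lborel (F \<nu> \<kappa>)" if "\<kappa> \<le> \<nu>" for \<nu> \<kappa>
    unfolding F_def using mlen_mono[OF that] assms by (intro integrable_V) simp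
  have "D_int e \<alpha> \<beta> \<mu> = (LINT g|lborel. (\<Sum>\<nu> | \<nu> \<le> \<alpha> \<and> meven (\<alpha> - \<nu>). hermite_coeff \<alpha> \<nu> *
        (\<Sum>\<kappa> | \<kappa> \<le> \<nu> \<and> meven (\<nu> - \<kappa>). c \<nu> \<kappa> * F \<nu> \<kappa> g)))"
    by (simp only: D_int_def inner)
  also have "\<dots> = (\<Sum>\<nu> | \<nu> \<le> \<alpha> \<and> meven (\<alpha> - \<nu>). hermite_coeff \<alpha> \<nu> *
        (\<Sum>\<kappa> | \<kappa> \<le> \<nu> \<and> meven (\<nu> - \<kappa>). c \<nu> \<kappa> * integral\<^sup>L lborel (F \<nu> \<kappa>)))"
  proof -
    have "integrable lborel (\<lambda>g. \<Sum>\<kappa> | \<kappa> \<le> \<nu> \<and> meven (\<nu> - \<kappa>). c \<nu> \<kappa> * F \<nu> \<kappa> g)"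
      and "(LINT g|lborel. (\<Sum>\<kappa> | \<kappa> \<le> \<nu> \<and> meven (\<nu> - \<kappa>). c \<nu> \<kappa> * F \<nu> \<kappa> g))
        = (\<Sum>\<kappa> | \<kappa> \<le> \<nu> \<and> meven (\<nu> - \<kappa>). c \<nu> \<kappa> * integral\<^sup>L lborel (F \<nu> \<kappa>))" for \<nu>
      using intF by (auto simp: Bochner_Integration.integral_sum)
    then show ?thesis
      by (simp add: Bochner_Integration.integral_sum)
  qed
  finally show ?thesis
    by (simp only: c_def F_def[abs_def] V_int_def)
qed

lemma psi_int_expansion:
  assumes "0 \<le> \<mu>"
  shows "psi_int \<alpha> \<beta> \<mu> =
       4 * pi * (\<Sum>\<nu> | \<nu> \<le> \<alpha> \<and> meven (\<alpha> - \<nu>). hermite_coeff \<alpha> \<nu> * V_int \<nu> \<beta> \<mu>)"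
proof -
  have "psi_int \<alpha> \<beta> \<mu> = (LINT g|lborel. 4 * pi *
      (\<Sum>\<nu> | \<nu> \<le> \<alpha> \<and> meven (\<alpha> - \<nu>). hermite_coeff \<alpha> \<nu> *
        (monom3 g \<nu> * Hermite \<beta> g * rpow (norm g) \<mu> * gauss_weight g)))"
    unfolding psi_int_def integral_sphere_const Hermite_expansion[of \<alpha>]
    by (simp add: sum_distrib_right mult.assoc)
  then show ?thesis
    using assms by (simp add: integrable_V Bochner_Integration.integral_sum V_int_def)
qed

theorem proposition4:
  fixes e \<mu> :: real and \<alpha> \<beta> :: "nat^3"
  assumes "0 \<le> e" and "e \<le> 1" and "0 \<le> \<mu>"
  shows
    "D_int e \<alpha> \<beta> \<mu> =
       (\<Sum>\<nu> | \<nu> \<le> \<alpha> \<and> meven (\<alpha> - \<nu>). hermite_coeff \<alpha> \<nu> *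
         (\<Sum>\<kappa> | \<kappa> \<le> \<nu> \<and> meven (\<nu> - \<kappa>).
            real (mchoose \<nu> \<kappa>) * ((1 - e) / 2) ^ mlen \<kappa> * ((1 + e) / 2) ^ (mlen \<nu> - mlen \<kappa>)
            * S_int (\<nu> - \<kappa>) * V_int \<kappa> \<beta> (real (mlen \<nu>) - real (mlen \<kappa>) + \<mu>)))
     \<and> psi_int \<alpha> \<beta> \<mu> =
       4 * pi * (\<Sum>\<nu> | \<nu> \<le> \<alpha> \<and> meven (\<alpha> - \<nu>). hermite_coeff \<alpha> \<nu> * V_int \<nu> \<beta> \<mu>)"
  using assms by (simp add: D_int_expansion psi_int_expansion)

end
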